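(* Let $n\geq 3$, let $q>0$ be a real number, and let $\rho,\sigma\in M_n(\mathbb{C})$ be density matrices. If $\mathcal{R}_q(\mu_\rho)_V=\mathcal{R}_q(\mu_\sigma)_V$ for every context $V\in\mathcal{V}(M_n)$, then $\rho=\sigma$. That is, a quantum state on a Hilbert space of finite dimension $n\ge3$ is uniquely determined by its contextual Rényi entropy of any parameter $q>0$.
   Context: Rényi entropy: for a probability distribution $(p_1,\dots,p_k)$ and real $q>0$, $q\neq1$, $R_q(p_1,\dots,p_k)=\frac{1}{1-q}\ln\big[\sum_{i=1}^k p_i^q\big]$; $R_1$ is the limit $q\to1$, i.e. the Shannon entropy $-\sum_i p_i\ln p_i$ (with $0\ln0=0$). $M_n=M_n(\mathbb{C})$. A density matrix is a positive semidefinite matrix of trace $1$. A context is a commutative $*$-subalgebra $V\subseteq M_n$ containing the identity $I$, with $V\neq\mathbb{C}I$; $\mathcal{V}(M_n)$ is the set of all contexts. Each context is $V=\mathbb{C}P_1+\dots+\mathbb{C}P_k$ for a unique (up to order) set of nonzero pairwise orthogonal projections summing to $I$ (its canonical projections); write $V=\{P_1,\dots,P_k\}''$. The contextual Rényi entropy of the state $\rho$ at the context $V=\{P_1,\dots,P_k\}''$ is $$\mathcal{R}_q(\mu_\rho)_V=R_q\big(\mathrm{Tr}(\rho P_1),\dots,\mathrm{Tr}(\rho P_k)\big).$$ *)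

theory Defs
  imports "HOL-Analysis.Analysis"
begin

section \<open>Complex matrices and states\<close>

text \<open>
  The algebra \<open>M\<^sub>n(\<complex>)\<close> is the type \<open>complex^'n^'n\<close> with \<open>n = CARD('n)\<close>. The library only
  provides real scalar multiples and plain transposes for this type.
\<close>

definition cscale :: "complex \<Rightarrow> complex^'n^'n \<Rightarrow> complex^'n^'n" where
  "cscale c A = map_matrix ((*) c) A"

definition dagger :: "complex^'n^'n \<Rightarrow> complex^'n^'n" where
  "dagger A = transpose (map_matrix cnj A)"

definition positive_semidefinite :: "complex^'n^'n \<Rightarrow> bool" where
  "positive_semidefinite A \<longleftrightarrow>
     dagger A = A \<and> (\<forall>x. 0 \<le> Re (\<Sum>i\<in>UNIV. cnj (x $ i) * (A *v x) $ i))"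

definition density_matrix :: "complex^'n^'n \<Rightarrow> bool" where
  "density_matrix \<rho> \<longleftrightarrow> positive_semidefinite \<rho> \<and> trace \<rho> = 1"

definition projection :: "complex^'n^'n \<Rightarrow> bool" where
  "projection P \<longleftrightarrow> P ** P = P \<and> dagger P = P"


section \<open>Contexts and their canonical projections\<close>

definition unital_star_subalgebra :: "(complex^'n^'n) set \<Rightarrow> bool" where
  "unital_star_subalgebra V \<longleftrightarrow>
     mat 1 \<in> V \<and>
     (\<forall>A\<in>V. \<forall>B\<in>V. A + B \<in> V) \<and>
     (\<forall>c. \<forall>A\<in>V. cscale c A \<in> V) \<and>
     (\<forall>A\<in>V. \<forall>B\<in>V. A ** B \<in> V) \<and>
     (\<forall>A\<in>V. dagger A \<in> V)"

definition contexts :: "(complex^'n^'n) set set" where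
  "contexts = {V. unital_star_subalgebra V \<and>
                  (\<forall>A\<in>V. \<forall>B\<in>V. A ** B = B ** A) \<and>
                  V \<noteq> range (\<lambda>c. cscale c (mat 1))}"

definition is_canonical_projections :: "(complex^'n^'n) set \<Rightarrow> (complex^'n^'n) set \<Rightarrow> bool" where
  "is_canonical_projections V S \<longleftrightarrow>
     finite S \<and>
     (\<forall>P\<in>S. projection P \<and> P \<noteq> 0) \<and>
     (\<forall>P\<in>S. \<forall>Q\<in>S. P \<noteq> Q \<longrightarrow> P ** Q = 0) \<and>
     (\<Sum>P\<in>S. P) = mat 1 \<and>
     V = range (\<lambda>c. \<Sum>P\<in>S. cscale (c P) P)"

definition canonical_projections :: "(complex^'n^'n) set \<Rightarrow> (complex^'n^'n) set" where
  "canonical_projections V = (THE S. is_canonical_projections V S)"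

lemma cscale_nth [simp]: "cscale c A $ i $ j = c * A $ i $ j"
  by (simp add: cscale_def map_matrix_def)

lemma cscale_mult_left: "cscale c A ** B = cscale c (A ** B)"
  by (simp add: vec_eq_iff matrix_matrix_mult_def sum_distrib_left mult.assoc)

lemma cscale_mult_right: "A ** cscale c B = cscale c (A ** B)"
  by (simp add: vec_eq_iff matrix_matrix_mult_def sum_distrib_left mult.left_commute)

lemma matrix_mult_sum_left:
  fixes f :: "'i \<Rightarrow> complex^'n^'n"
  shows "(\<Sum>x\<in>S. f x) ** B = (\<Sum>x\<in>S. f x ** B)"
proof (induction S rule: infinite_finite_induct)
  case (insert x S)
  have "(A + C) ** B = A ** B + C ** B" for A C :: "complex^'n^'n"
    by (simp add: vec_eq_iff matrix_matrix_mult_def distrib_right sum.distrib)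
  with insert show ?case by simp
qed simp_all

lemma matrix_mult_sum_right:
  fixes f :: "'i \<Rightarrow> complex^'n^'n"
  shows "B ** (\<Sum>x\<in>S. f x) = (\<Sum>x\<in>S. B ** f x)"
  by (induction S rule: infinite_finite_induct) (simp_all add: matrix_add_ldistrib)

lemma is_canonical_projections_mult:
  fixes V :: "(complex^'n^'n) set"
  assumes "is_canonical_projections V S" "P \<in> S" "A \<in> V"
  shows "\<exists>d. P ** A = cscale d P \<and> A ** P = cscale d P"
proof -
  obtain c where A: "A = (\<Sum>Q\<in>S. cscale (c Q) Q)"
    using assms(1,3) by (auto simp: is_canonical_projections_def)
  have fin: "finite S" and idem: "P ** P = P"
    and orth: "\<And>Q. Q \<in> S \<Longrightarrow> Q \<noteq> P \<Longrightarrow> P ** Q = 0 \<and> Q ** P = 0"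
    using assms(1,2) by (auto simp: is_canonical_projections_def projection_def)
  have z: "cscale d 0 = (0 :: complex^'n^'n)" for d
    by (simp add: vec_eq_iff)
  have "P ** A = (\<Sum>Q\<in>S. if Q = P then cscale (c P) P else 0)"
    unfolding A matrix_mult_sum_right
    by (rule sum.cong) (auto simp: cscale_mult_right idem orth z)
  moreover have "A ** P = (\<Sum>Q\<in>S. if Q = P then cscale (c P) P else 0)"
    unfolding A matrix_mult_sum_left
    by (rule sum.cong) (auto simp: cscale_mult_left idem orth z)
  ultimately show ?thesis
    using fin assms(2) by auto
qed

lemma is_canonical_projections_subset:
  fixes V :: "(complex^'n^'n) set"
  assumes "is_canonical_projections V S"
  shows "S \<subseteq> V"
proof
  fix P assume P: "P \<in> S"
  have fin: "finite S" and V: "V = range (\<lambda>c. \<Sum>P\<in>S. cscale (c P) P)"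
    using assms by (auto simp: is_canonical_projections_def)
  have "(\<Sum>Q\<in>S. cscale (if Q = P then 1 else 0) Q) = (\<Sum>Q\<in>S. if Q = P then P else 0)"
    by (rule sum.cong) (auto simp: vec_eq_iff)
  also have "\<dots> = P"
    using fin P by simp
  finally show "P \<in> V"
    unfolding V by (intro range_eqI[where x = "\<lambda>Q. if Q = P then 1 else 0"]) (rule sym)
qed

lemma is_canonical_projections_subset_unique:
  fixes V :: "(complex^'n^'n) set"
  assumes S: "is_canonical_projections V S" and T: "is_canonical_projections V T"
  shows "S \<subseteq> T"
proof
  fix P assume P: "P \<in> S"
  have idemP: "P ** P = P" and nz: "P \<noteq> 0"
    using S P by (auto simp: is_canonical_projections_def projection_def)
  have "(\<Sum>Q\<in>T. P ** Q) = P ** (\<Sum>Q\<in>T. Q)"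
    by (simp add: matrix_mult_sum_right)
  also have "\<dots> = P"
    using T by (simp add: is_canonical_projections_def)
  finally have "(\<Sum>Q\<in>T. P ** Q) \<noteq> 0"
    using nz by simp
  then obtain Q where Q: "Q \<in> T" and PQ: "P ** Q \<noteq> 0"
    by (meson sum.not_neutral_contains_not_neutral)
  have idemQ: "Q ** Q = Q"
    using T Q by (auto simp: is_canonical_projections_def projection_def)
  obtain d where d: "P ** Q = cscale d P"
    using is_canonical_projections_mult[OF S P] is_canonical_projections_subset[OF T] Q by blast
  obtain e where e: "P ** Q = cscale e Q"
    using is_canonical_projections_mult[OF T Q] is_canonical_projections_subset[OF S] P by blast
  have ne: "d \<noteq> 0" "e \<noteq> 0"
    using PQ d e by (auto simp: vec_eq_iff)
  have "cscale d (P ** Q) = P ** Q ** Q"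
    by (metis d cscale_mult_left)
  also have "\<dots> = P ** Q"
    by (metis idemQ matrix_mul_assoc)
  finally have "d * (P ** Q) $ i $ j = (P ** Q) $ i $ j" for i j
    by (metis cscale_nth)
  with PQ have d1: "d = 1"
    by (auto simp: vec_eq_iff)
  have "cscale e (P ** Q) = P ** (P ** Q)"
    by (metis e cscale_mult_right)
  also have "\<dots> = P ** Q"
    by (metis idemP matrix_mul_assoc)
  finally have "e * (P ** Q) $ i $ j = (P ** Q) $ i $ j" for i j
    by (metis cscale_nth)
  with PQ have e1: "e = 1"
    by (auto simp: vec_eq_iff)
  have "P = Q"
    using d e d1 e1 by (simp add: vec_eq_iff)
  with Q show "P \<in> T" by simp
qed

lemma canonical_projections_eq:
  assumes "is_canonical_projections V S"
  shows "canonical_projections V = S"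
  unfolding canonical_projections_def
proof (rule the_equality)
  show "T = S" if "is_canonical_projections V T" for T
    using is_canonical_projections_subset_unique[OF that assms]
      is_canonical_projections_subset_unique[OF assms that] by simp
qed (fact assms)


section \<open>Contextual Renyi entropy\<close>

text \<open>
  A finite family is indexed by a set, so that equal values are counted with multiplicity. The
  convention \<open>0 ln 0 = 0\<close> holds since \<open>0 * x = 0\<close>, and \<open>0 powr q = 0\<close> for every \<open>q\<close>.
\<close>

definition renyi_entropy :: "real \<Rightarrow> 'i set \<Rightarrow> ('i \<Rightarrow> real) \<Rightarrow> real" where
  "renyi_entropy q I p =
     (if q = 1 then - (\<Sum>i\<in>I. p i * ln (p i))
      else 1 / (1 - q) * ln (\<Sum>i\<in>I. p i powr q))"

lemma renyi_entropy_tendsto_1: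
  assumes fin: "finite I" and nonneg: "\<And>i. i \<in> I \<Longrightarrow> 0 \<le> p i" and sum1: "(\<Sum>i\<in>I. p i) = 1"
  shows "((\<lambda>q. renyi_entropy q I p) \<longlongrightarrow> renyi_entropy 1 I p) (at 1)"
proof -
  let ?F = "\<lambda>q. \<Sum>i\<in>I. p i powr q"
  have F1: "?F 1 = 1"
    using sum1 nonneg by simp
  have "((\<lambda>q. p i powr q) has_real_derivative p i * ln (p i)) (at 1)" if "i \<in> I" for i
  proof (cases "p i = 0")
    case False
    with nonneg[OF that] have "0 < p i" by simp
    then show ?thesis
      by (auto intro!: derivative_eq_intros)
  qed simp
  then have "(?F has_real_derivative (\<Sum>i\<in>I. p i * ln (p i))) (at 1)"
    by (rule DERIV_sum)
  then have "((\<lambda>q. ln (?F q)) has_real_derivative (\<Sum>i\<in>I. p i * ln (p i))) (at 1)"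
    using DERIV_chain2[where f = ln and g = ?F and Da = 1 and x = 1] DERIV_ln[of 1] F1 by simp
  then have "((\<lambda>q. (ln (?F q) - ln (?F 1)) / (q - 1)) \<longlongrightarrow> (\<Sum>i\<in>I. p i * ln (p i))) (at 1)"
    by (simp add: has_field_derivative_iff)
  from tendsto_minus[OF this]
  have "((\<lambda>q. - (ln (?F q) / (q - 1))) \<longlongrightarrow> renyi_entropy 1 I p) (at 1)"
    unfolding F1 renyi_entropy_def by simp
  moreover have "- (ln (?F q) / (q - 1)) = renyi_entropy q I p" if "q \<noteq> 1" for q
    using that by (simp add: renyi_entropy_def minus_divide_right)
  then have "\<forall>\<^sub>F q in at 1. - (ln (?F q) / (q - 1)) = renyi_entropy q I p"
    by (simp add: eventually_at_filter)
  ultimately show ?thesis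
    by (rule Lim_transform_eventually)
qed

text \<open>
  The numbers \<open>trace (\<rho> ** P)\<close> are real for a state \<open>\<rho>\<close> and a projection \<open>P\<close>, so \<open>Re\<close> only
  changes the type.
\<close>

definition contextual_renyi_entropy ::
    "real \<Rightarrow> complex^'n^'n \<Rightarrow> (complex^'n^'n) set \<Rightarrow> real" where
  "contextual_renyi_entropy q \<rho> V =
     renyi_entropy q (canonical_projections V) (\<lambda>P. Re (trace (\<rho> ** P)))"

end

theory Submission
  imports Defs "HOL-Real_Asymp.Real_Asymp"
begin

text \<open>
  Contexts \<open>{P, I - P}''\<close> with \<open>P\<close> of rank one already suffice. The binary Renyi entropy
  determines its argument up to \<open>t \<mapsto> 1 - t\<close>, so for every vector \<open>x\<close> one of the Hermitian forms
  of \<open>\<rho> - \<sigma>\<close> and \<open>\<rho> + \<sigma> - I\<close> vanishes at \<open>x\<close>. Restricted to a line, the product of two such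
  forms is a product of real polynomials, so one of the forms vanishes identically. The second
  one cannot, because \<open>\<rho> + \<sigma> - I\<close> has trace \<open>2 - n \<noteq> 0\<close>.
\<close>

section \<open>Binary entropies\<close>

text \<open>\<open>h z + h (1 - z)\<close> is symmetric about 1/2, and by Rolle two equal values on
  [0, 1/2] would give some z < 1/2 with \<open>h' z = h' (1 - z)\<close>. Injectivity of
  \<open>h'\<close> treats convex and concave \<open>h\<close> alike.\<close>

lemma symmetric_sum_eqD:
  fixes h h' :: "real \<Rightarrow> real"
  assumes cont: "continuous_on {0..1} h"
    and deriv: "\<And>z. z \<in> {0<..<1} \<Longrightarrow> (h has_real_derivative h' z) (at z)"
    and inj: "inj_on h' {0<..<1}"
    and st: "s \<in> {0..1}" "t \<in> {0..1}"
    and eq: "h s + h (1 - s) = h t + h (1 - t)"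
  shows "s = t \<or> s = 1 - t"
proof -
  define g where "g z = h z + h (1 - z)" for z
  have no_eq: "g a \<noteq> g b" if ab: "0 \<le> a" "a < b" "b \<le> 1/2" for a b
  proof
    assume "g a = g b"
    have "continuous_on {a..b} (\<lambda>z. h (1 - z))"
      by (rule continuous_on_compose2[OF cont]) (use ab in \<open>auto intro!: continuous_intros\<close>)
    moreover have "continuous_on {a..b} h"
      by (rule continuous_on_subset[OF cont]) (use ab in auto)
    ultimately have "continuous_on {a..b} g"
      unfolding g_def by (intro continuous_intros)
    moreover have der: "(g has_real_derivative h' z - h' (1 - z)) (at z)" if "a < z" "z < b" for z
    proof -
      have "((\<lambda>z. h (1 - z)) has_real_derivative h' (1 - z) * (- 1)) (at z)"
        by (rule DERIV_chain2[where f = h])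
          (use that ab in \<open>auto intro!: deriv derivative_eq_intros\<close>)
      from DERIV_add[OF deriv[of z] this] show ?thesis
        using that ab by (simp add: g_def[abs_def])
    qed
    ultimately obtain z where z: "a < z" "z < b" "(g has_real_derivative 0) (at z)"
      using Rolle[of a b g] \<open>g a = g b\<close> ab by (auto simp: real_differentiable_def)
    then have "h' z = h' (1 - z)"
      using der DERIV_unique by fastforce
    then have "z = 1 - z"
      using inj z ab by (auto dest!: inj_onD)
    then show False using z ab by simp
  qed
  \<comment> \<open>Folding at 1/2 leaves \<open>g\<close> unchanged and moves both arguments into
    the interval where \<open>no_eq\<close> applies.\<close>
  define m where "m z = min z (1 - z)" for z :: real
  have "g (m s) = g (m t)"
    using eq by (simp add: g_def m_def min_def)
  moreover have "0 \<le> m s" "m s \<le> 1/2" "0 \<le> m t" "m t \<le> 1/2"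
    using st by (auto simp: m_def min_def)
  ultimately have "m s = m t"
    using no_eq by (metis linorder_neqE)
  then show ?thesis
    by (auto simp: m_def min_def split: if_splits)
qed

text \<open>Rolle's theorem asks for continuity up to the endpoint 0, where \<open>ln\<close> is
  unbounded but \<open>x * ln x\<close> tends to 0.\<close>

lemma continuous_on_mult_ln: "continuous_on {0..} (\<lambda>x. x * ln x :: real)"
  unfolding continuous_on_def
proof
  fix x :: real assume "x \<in> {0..}"
  show "((\<lambda>x. x * ln x) \<longlongrightarrow> x * ln x) (at x within {0..})"
  proof (cases "x = 0")
    case True
    have "((\<lambda>x::real. x * ln x) \<longlongrightarrow> 0) (at_right 0)"
      by real_asymp
    moreover have "at (0::real) within {0..} = at_right 0"
      by (rule at_within_nhd[where S = UNIV]) auto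
    ultimately show ?thesis using True by simp
  next
    case False
    then show ?thesis by (auto intro!: tendsto_intros)
  qed
qed

text \<open>At least one of t and 1 - t is positive; this allows \<open>ln\<close> to be cancelled
  from an equation of entropies.\<close>

lemma binary_powr_sum_pos:
  fixes q t :: real
  assumes "t \<in> {0..1}"
  shows "0 < t powr q + (1 - t) powr q"
  using assms by (cases "t = 0") (auto intro!: add_pos_nonneg)

text \<open>Each binary entropy is an injective function of \<open>h s + h (1 - s)\<close>, with
  \<open>h x = x * ln x\<close> for q = 1 and \<open>h x = x powr q\<close> otherwise. The
  derivative of \<open>h\<close> is injective on (0, 1), in the second case because q is neither 0
  nor 1.\<close>

lemma binary_renyi_entropy_eqD:
  assumes "q > 0" and "P \<noteq> Q"
    and "s P \<in> {0..1}" "t P \<in> {0..1}" "s Q = 1 - s P" "t Q = 1 - t P"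
    and eq: "renyi_entropy q {P, Q} s = renyi_entropy q {P, Q} t"
  shows "s P = t P \<or> s P = 1 - t P"
proof (cases "q = 1")
  case True
  show ?thesis
  proof (rule symmetric_sum_eqD[where h = "\<lambda>x. x * ln x" and h' = "\<lambda>x. ln x + 1"])
    show "continuous_on {0..1} (\<lambda>x. x * ln x :: real)"
      by (rule continuous_on_subset[OF continuous_on_mult_ln]) auto
    show "((\<lambda>x. x * ln x) has_real_derivative ln z + 1) (at z)" if "z \<in> {0<..<1}" for z :: real
      using that by (auto intro!: derivative_eq_intros)
    show "inj_on (\<lambda>x::real. ln x + 1) {0<..<1}"
      by (auto simp: inj_on_def)
  qed (use assms True in \<open>auto simp: renyi_entropy_def\<close>)
next
  case False
  show ?thesis
  proof (rule symmetric_sum_eqD[where h = "\<lambda>x. x powr q" and h' = "\<lambda>x. q * x powr (q - 1)"])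
    show "continuous_on {0..1} (\<lambda>x. x powr q :: real)"
      using \<open>q > 0\<close> by (intro continuous_on_powr') (auto intro!: continuous_intros)
    show "((\<lambda>x. x powr q) has_real_derivative q * z powr (q - 1)) (at z)"
      if "z \<in> {0<..<1}" for z :: real
      using that by (auto intro!: derivative_eq_intros)
    show "inj_on (\<lambda>x::real. q * x powr (q - 1)) {0<..<1}"
    proof (rule inj_onI)
      fix x y :: real
      assume "x \<in> {0<..<1}" "y \<in> {0<..<1}" "q * x powr (q - 1) = q * y powr (q - 1)"
      moreover from this have "(q - 1) * ln x = (q - 1) * ln y"
        using \<open>q > 0\<close> by (metis greaterThanLessThan_iff ln_powr mult_cancel_left less_irrefl)
      ultimately show "x = y"
        using False by simp
    qed
    have "ln (s P powr q + (1 - s P) powr q) = ln (t P powr q + (1 - t P) powr q)"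
      using eq assms False by (simp add: renyi_entropy_def)
    then show "s P powr q + (1 - s P) powr q = t P powr q + (1 - t P) powr q"
      using binary_powr_sum_pos assms by (metis ln_inj_iff)
  qed (use assms in auto)
qed


section \<open>Hermitian forms\<close>

definition sesq :: "complex^'n^'n \<Rightarrow> complex^'n \<Rightarrow> complex^'n \<Rightarrow> complex" where
  "sesq A x y = (\<Sum>i\<in>UNIV. \<Sum>j\<in>UNIV. cnj (x $ i) * A $ i $ j * y $ j)"

text \<open>The form is real for Hermitian \<open>A\<close>; taking \<open>Re\<close> makes its
  restriction to a real line a real polynomial for every \<open>A\<close>.\<close>

definition quad :: "complex^'n^'n \<Rightarrow> complex^'n \<Rightarrow> real" where
  "quad A x = Re (sesq A x x)"

lemma positive_semidefinite_iff:
  "positive_semidefinite A \<longleftrightarrow> dagger A = A \<and> (\<forall>x. 0 \<le> quad A x)"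
  by (simp add: positive_semidefinite_def quad_def sesq_def matrix_vector_mult_def
      sum_distrib_left mult.assoc)

lemma sesq_add_left: "sesq A (x + y) z = sesq A x z + sesq A y z"
  by (simp add: sesq_def sum.distrib distrib_right)

lemma sesq_add_right: "sesq A x (y + z) = sesq A x y + sesq A x z"
  by (simp add: sesq_def sum.distrib distrib_left)

lemma sesq_scaleR_left: "sesq A (r *\<^sub>R x) y = r * sesq A x y"
  by (simp add: sesq_def scaleR_sum_right flip: scaleR_conv_of_real)

lemma sesq_scaleR_right: "sesq A x (r *\<^sub>R y) = r * sesq A x y"
  by (simp add: sesq_def scaleR_sum_right flip: scaleR_conv_of_real)

lemma sesq_axis: "sesq A (axis i a) (axis j b) = cnj a * A $ i $ j * b"
proof -
  have "sesq A (axis i a) (axis j b) =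
    (\<Sum>k\<in>UNIV. \<Sum>l\<in>UNIV. if l = j then (if k = i then cnj a * A $ i $ j * b else 0) else 0)"
    unfolding sesq_def by (intro sum.cong) (auto simp: axis_def)
  then show ?thesis by simp
qed

lemma quad_add_matrix: "quad (A + B) x = quad A x + quad B x"
  by (simp add: quad_def sesq_def sum.distrib distrib_left distrib_right)

lemma quad_diff_matrix: "quad (A - B) x = quad A x - quad B x"
  by (simp add: quad_def sesq_def sum_subtractf left_diff_distrib right_diff_distrib)

lemma quad_mat_1: "quad (mat 1) x = (norm x)\<^sup>2"
proof -
  have "sesq (mat 1) x x = (\<Sum>i\<in>UNIV. \<Sum>j\<in>UNIV. if j = i then cnj (x $ i) * x $ i else 0)"
    unfolding sesq_def by (intro sum.cong) (auto simp: mat_def)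
  then show ?thesis
    by (simp add: quad_def norm_vec_def L2_set_def sum_nonneg cmod_power2)
      (simp add: power2_eq_square)
qed

text \<open>The parameter t is real, so conjugation leaves it alone and only powers of t up to 2
  appear.\<close>

lemma quad_line:
  "quad A (x + t *\<^sub>R y) = poly [:quad A x, Re (sesq A x y + sesq A y x), quad A y:] t"
  by (simp add: quad_def sesq_add_left sesq_add_right sesq_scaleR_left sesq_scaleR_right
      algebra_simps)

text \<open>Real polynomials have no zero divisors. If the forms are nonzero at x and y
  respectively, then on the line x + t y the first polynomial has a nonzero constant term and the
  second a nonzero coefficient at t^2.\<close>

lemma quad_mult_eq_0D:
  assumes "\<And>x. quad A x * quad B x = 0"
  shows "(\<forall>x. quad A x = 0) \<or> (\<forall>x. quad B x = 0)"
proof (rule ccontr)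
  assume "\<not> ?thesis"
  then obtain x y where xy: "quad A x \<noteq> 0" "quad B y \<noteq> 0" by blast
  let ?a = "[:quad A x, Re (sesq A x y + sesq A y x), quad A y:]"
  let ?b = "[:quad B x, Re (sesq B x y + sesq B y x), quad B y:]"
  have "poly (?a * ?b) t = 0" for t
    unfolding poly_mult quad_line[symmetric] by (rule assms)
  then have "?a * ?b = 0"
    by (metis poly_all_0_iff_0)
  \<comment> \<open>Keeping the product unexpanded lets the zero-divisor rule apply.\<close>
  then show False
    using xy by (simp del: mult_pCons_left mult_pCons_right)
qed

lemma dagger_nth: "dagger A $ i $ j = cnj (A $ j $ i)"
  by (simp add: dagger_def transpose_def map_matrix_def)

text \<open>Polarization: the value at \<open>axis i 1 + axis j c\<close> isolates twice the real
  part of \<open>c * A $ i $ j\<close>, and c = 1 and c = \<i> give the real and imaginary parts of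
  the entry.\<close>

lemma hermitian_eq_0I:
  assumes herm: "dagger A = A" and zero: "\<And>x. quad A x = 0"
  shows "A = 0"
proof -
  have cnj: "cnj (A $ i $ j) = A $ j $ i" for i j
    by (metis herm dagger_nth)
  have polar: "2 * Re (c * A $ i $ j) = 0" for c i j
  proof -
    have "quad A (axis i 1 + axis j c) =
        quad A (axis i 1) + quad A (axis j c) + Re (A $ i $ j * c + cnj c * A $ j $ i)"
      by (simp add: quad_def sesq_add_left sesq_add_right sesq_axis)
    then have "Re (A $ i $ j * c + cnj c * cnj (A $ i $ j)) = 0"
      by (simp add: zero cnj)
    then show ?thesis by simp
  qed
  have "A $ i $ j = 0" for i j
    using polar[of 1 i j] polar[of \<i> i j] by (simp add: complex_eq_iff)
  then show ?thesis by (simp add: vec_eq_iff)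
qed


section \<open>Two-element contexts\<close>

lemma dagger_add: "dagger (A + B) = dagger A + dagger B"
  by (simp add: vec_eq_iff dagger_nth)

lemma dagger_diff: "dagger (A - B) = dagger A - dagger B"
  by (simp add: vec_eq_iff dagger_nth)

lemma dagger_cscale: "dagger (cscale c A) = cscale (cnj c) (dagger A)"
  by (simp add: vec_eq_iff dagger_nth)

lemma dagger_mat_1: "dagger (mat 1) = mat 1"
  by (simp add: vec_eq_iff dagger_nth mat_def)

lemma matrix_mult_diff_left: "(A - B) ** C = A ** C - B ** (C :: complex^'n^'n)"
  by (simp add: vec_eq_iff matrix_matrix_mult_def left_diff_distrib sum_subtractf)

lemma matrix_mult_diff_right: "C ** (A - B) = C ** A - C ** (B :: complex^'n^'n)"
  by (simp add: vec_eq_iff matrix_matrix_mult_def right_diff_distrib sum_subtractf)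

lemma matrix_mult_add_left: "(A + B) ** C = A ** C + B ** (C :: complex^'n^'n)"
  by (simp add: vec_eq_iff matrix_matrix_mult_def distrib_right sum.distrib)

lemma projection_compl:
  assumes "projection P"
  shows "projection (mat 1 - P)"
  using assms by (simp add: projection_def matrix_mult_diff_left matrix_mult_diff_right
      dagger_diff dagger_mat_1)

text \<open>For a projection \<open>P\<close> this is the star algebra {P, I - P}'', spelled out by
  coefficients.\<close>

definition binary_context :: "complex^'n^'n \<Rightarrow> (complex^'n^'n) set" where
  "binary_context P = {cscale a P + cscale b (mat 1 - P) | a b. True}"

text \<open>Guarantees that the set {P, I - P} has two elements, so that entropy sums over it have
  two terms.\<close>

lemma projection_neq_compl:
  assumes "projection P" "P \<noteq> 0"
  shows "P \<noteq> mat 1 - P"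
proof
  assume "P = mat 1 - P"
  then have "P ** P = P ** (mat 1 - P)" by (rule arg_cong)
  also have "\<dots> = 0"
    using assms(1) by (simp add: projection_def matrix_mult_diff_right)
  finally show False
    using assms by (simp add: projection_def)
qed

text \<open>Together with \<open>canonical_projections_eq\<close> this evaluates the definite
  description in \<open>canonical_projections\<close>.\<close>

lemma is_canonical_projections_binary_context:
  assumes P: "projection P" "P \<noteq> 0" "P \<noteq> mat 1"
  shows "is_canonical_projections (binary_context P) {P, mat 1 - P}"
proof -
  have ne: "P \<noteq> mat 1 - P"
    by (rule projection_neq_compl) (fact P)+
  have "binary_context P = range (\<lambda>c. \<Sum>Q\<in>{P, mat 1 - P}. cscale (c Q) Q)"
  proof (intro equalityI subsetI)
    fix A assume "A \<in> binary_context P"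
    then obtain a b where A: "A = cscale a P + cscale b (mat 1 - P)"
      by (auto simp: binary_context_def)
    show "A \<in> range (\<lambda>c. \<Sum>Q\<in>{P, mat 1 - P}. cscale (c Q) Q)"
      by (rule range_eqI[where x = "\<lambda>Q. if Q = P then a else b"]) (use A ne in auto)
  qed (use ne in \<open>auto simp: binary_context_def\<close>)
  then show ?thesis
    using P ne projection_compl[OF P(1)]
    by (auto simp: is_canonical_projections_def projection_def
        matrix_mult_diff_left matrix_mult_diff_right)
qed

text \<open>By orthogonality the coefficients multiply as for diagonal matrices; closure under
  products and commutativity follow at once.\<close>

lemma binary_context_mult:
  assumes "projection P"
  shows "(cscale a P + cscale b (mat 1 - P)) ** (cscale c P + cscale d (mat 1 - P)) =
    cscale (a * c) P + cscale (b * d) (mat 1 - P)"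
proof -
  have idem: "P ** P = P" "(mat 1 - P) ** (mat 1 - P) = mat 1 - P"
    using assms projection_compl[OF assms] by (auto simp: projection_def)
  then have orth: "P ** (mat 1 - P) = 0" "(mat 1 - P) ** P = 0"
    by (simp_all add: matrix_mult_diff_left matrix_mult_diff_right)
  show ?thesis
    by (simp add: matrix_mult_add_left matrix_add_ldistrib cscale_mult_left cscale_mult_right
        idem orth) (simp add: vec_eq_iff)
qed

lemma binary_context_in_contexts:
  assumes P: "projection P" "P \<noteq> 0" "P \<noteq> mat 1"
  shows "binary_context P \<in> contexts"
proof -
  have I: "cscale a P + cscale b (mat 1 - P) \<in> binary_context P" for a b
    by (auto simp: binary_context_def)
  have "cscale 1 P + cscale 1 (mat 1 - P) = mat 1"
    by (simp add: vec_eq_iff)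
  then have one: "mat 1 \<in> binary_context P"
    by (metis I)
  have "cscale 1 P + cscale 0 (mat 1 - P) = P"
    by (simp add: vec_eq_iff)
  then have P_in: "P \<in> binary_context P"
    by (metis I)
  have E: "\<exists>a b. A = cscale a P + cscale b (mat 1 - P)" if "A \<in> binary_context P" for A
    using that by (auto simp: binary_context_def)
  have add: "A + B \<in> binary_context P" and mult: "A ** B \<in> binary_context P"
    and comm: "A ** B = B ** A"
    if "A \<in> binary_context P" "B \<in> binary_context P" for A B
  proof -
    obtain a b where A: "A = cscale a P + cscale b (mat 1 - P)"
      using E[OF \<open>A \<in> _\<close>] by blast
    obtain c d where B: "B = cscale c P + cscale d (mat 1 - P)"
      using E[OF \<open>B \<in> _\<close>] by blast
    have "A + B = cscale (a + c) P + cscale (b + d) (mat 1 - P)"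
      unfolding A B by (simp add: vec_eq_iff algebra_simps)
    then show "A + B \<in> binary_context P" by (simp only: I)
    show "A ** B \<in> binary_context P"
      unfolding A B binary_context_mult[OF P(1)] by (rule I)
    show "A ** B = B ** A"
      unfolding A B binary_context_mult[OF P(1)] by (simp only: mult.commute)
  qed
  have scale: "cscale c A \<in> binary_context P" and dagger: "dagger A \<in> binary_context P"
    if "A \<in> binary_context P" for c A
  proof -
    obtain a b where A: "A = cscale a P + cscale b (mat 1 - P)"
      using E[OF \<open>A \<in> _\<close>] by blast
    have "cscale c A = cscale (c * a) P + cscale (c * b) (mat 1 - P)"
      unfolding A by (simp add: vec_eq_iff algebra_simps)
    then show "cscale c A \<in> binary_context P" by (simp only: I)
    have "dagger A = cscale (cnj a) P + cscale (cnj b) (mat 1 - P)"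
      using P(1) projection_compl[OF P(1)]
      by (simp add: A dagger_add dagger_cscale projection_def)
    then show "dagger A \<in> binary_context P" by (simp only: I)
  qed
  \<comment> \<open>A scalar matrix c I that is a nonzero idempotent has c = 1, hence is the
    identity.\<close>
  have "P \<notin> range (\<lambda>c. cscale c (mat 1))"
  proof
    assume "P \<in> range (\<lambda>c. cscale c (mat 1))"
    then obtain c where c: "P = cscale c (mat 1)" by blast
    then have "cscale c P = P"
      using P(1) by (metis projection_def cscale_mult_left matrix_mul_lid)
    then have "c * P $ i $ j = P $ i $ j" for i j
      by (metis cscale_nth)
    moreover obtain i j where "P $ i $ j \<noteq> 0"
      using P(2) by (auto simp: vec_eq_iff)
    ultimately have "c = 1" by (metis mult_cancel_right1)
    with c P(3) show False by (simp add: vec_eq_iff)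
  qed
  then have "binary_context P \<noteq> range (\<lambda>c. cscale c (mat 1))"
    using P_in by metis
  then show ?thesis
    unfolding contexts_def unital_star_subalgebra_def
    by (intro CollectI conjI ballI allI one add scale mult comm dagger)
qed


section \<open>States on projections\<close>

text \<open>The trace equals that of \<open>P ** \<rho> ** P\<close> by cyclicity, which is the sum
  of the form of \<open>\<rho>\<close> over the columns of \<open>P\<close>.\<close>

lemma Re_trace_mult_projection_nonneg:
  assumes "positive_semidefinite \<rho>" and P: "projection P"
  shows "0 \<le> Re (trace (\<rho> ** P))"
proof -
  have herm: "cnj (P $ j $ i) = P $ i $ j" for i j
    using P by (metis projection_def dagger_nth)
  have "trace (\<rho> ** P) = trace (P ** \<rho> ** P)"
    using P by (metis projection_def trace_mul_sym matrix_mul_assoc)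
  also have "\<dots> = (\<Sum>k\<in>UNIV. sesq \<rho> (column k P) (column k P))"
    by (simp add: trace_def matrix_matrix_mult_def sesq_def column_def herm sum_distrib_right)
      (intro sum.cong refl sum.swap)
  finally show ?thesis
    using assms by (simp add: positive_semidefinite_iff quad_def sum_nonneg)
qed

lemma Re_trace_mult_compl:
  assumes "trace \<rho> = 1"
  shows "Re (trace (\<rho> ** (mat 1 - P))) = 1 - Re (trace (\<rho> ** P))"
  using assms by (simp add: matrix_mult_diff_right trace_sub)

lemma contextual_renyi_entropy_eqD:
  fixes \<rho> \<sigma> P :: "complex^'n^'n"
  assumes "q > 0" "density_matrix \<rho>" "density_matrix \<sigma>"
    and P: "projection P" "P \<noteq> 0" "P \<noteq> mat 1"
    and eq: "contextual_renyi_entropy q \<rho> (binary_context P) =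
      contextual_renyi_entropy q \<sigma> (binary_context P)"
  shows "Re (trace (\<rho> ** P)) = Re (trace (\<sigma> ** P)) \<or>
    Re (trace (\<rho> ** P)) = 1 - Re (trace (\<sigma> ** P))"
proof (rule binary_renyi_entropy_eqD[where q = q and P = P and Q = "mat 1 - P"
      and s = "\<lambda>P. Re (trace (\<rho> ** P))" and t = "\<lambda>P. Re (trace (\<sigma> ** P))"])
  \<comment> \<open>The upper bound 1 is nonnegativity at the complementary projection.\<close>
  have range: "Re (trace (\<tau> ** P)) \<in> {0..1}" if "density_matrix \<tau>" for \<tau> :: "complex^'n^'n"
    using that Re_trace_mult_projection_nonneg[of \<tau>, OF _ P(1)] Re_trace_mult_compl[of \<tau> P]
      Re_trace_mult_projection_nonneg[of \<tau>, OF _ projection_compl[OF P(1)]]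
    by (auto simp: density_matrix_def)
  show "Re (trace (\<rho> ** P)) \<in> {0..1}" "Re (trace (\<sigma> ** P)) \<in> {0..1}"
    using range assms by blast+
  show "renyi_entropy q {P, mat 1 - P} (\<lambda>P. Re (trace (\<rho> ** P))) =
      renyi_entropy q {P, mat 1 - P} (\<lambda>P. Re (trace (\<sigma> ** P)))"
    using eq canonical_projections_eq[OF is_canonical_projections_binary_context[OF P]]
    by (simp add: contextual_renyi_entropy_def)
  show "P \<noteq> mat 1 - P"
    by (rule projection_neq_compl) (fact P)+
qed (use assms in \<open>simp_all add: density_matrix_def Re_trace_mult_compl\<close>)

text \<open>The orthogonal projection onto the span of x. Dividing by the squared norm admits
  vectors that are not normalized.\<close>

definition line_projection :: "complex^'n \<Rightarrow> complex^'n^'n" where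
  "line_projection x = (\<chi> i j. x $ i * cnj (x $ j) / (norm x)\<^sup>2)"

lemma sum_mult_cnj: "(\<Sum>k\<in>UNIV. x $ k * cnj (x $ k)) = complex_of_real ((norm x)\<^sup>2)"
  by (simp add: norm_vec_def L2_set_def sum_nonneg complex_norm_square del: of_real_power)

lemma projection_line_projection: "projection (line_projection x)"
proof (cases "x = 0")
  case False
  let ?N = "complex_of_real ((norm x)\<^sup>2)"
  have N: "?N \<noteq> 0" using False by simp
  have "(line_projection x ** line_projection x) $ i $ j = line_projection x $ i $ j" for i j
  proof -
    have "(line_projection x ** line_projection x) $ i $ j =
        (\<Sum>k\<in>UNIV. (x $ k * cnj (x $ k)) * (x $ i * cnj (x $ j) / (?N * ?N)))"
      by (simp add: matrix_matrix_mult_def line_projection_def mult_ac)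
    also have "\<dots> = ?N * (x $ i * cnj (x $ j) / (?N * ?N))"
      by (simp only: sum_distrib_right[symmetric] sum_mult_cnj)
    also have "\<dots> = line_projection x $ i $ j"
      using N by (simp add: line_projection_def del: of_real_power)
    finally show ?thesis .
  qed
  then show ?thesis
    by (simp add: projection_def vec_eq_iff dagger_nth) (simp add: line_projection_def mult.commute)
\<comment> \<open>For x = 0 the division by zero yields the zero matrix, again a projection.\<close>
qed (simp add: projection_def vec_eq_iff dagger_nth line_projection_def matrix_matrix_mult_def)

text \<open>Turns probabilities at rank-one projections into Rayleigh quotients, so that entropies
  speak about Hermitian forms.\<close>

lemma Re_trace_mult_line_projection:
  "Re (trace (A ** line_projection x)) = quad A x / (norm x)\<^sup>2"
proof -
  have "trace (A ** line_projection x) = sesq A x x / complex_of_real ((norm x)\<^sup>2)"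
    by (simp add: trace_def matrix_matrix_mult_def line_projection_def sesq_def sum_divide_distrib
        mult_ac)
  then show ?thesis
    by (simp only: quad_def Re_divide_of_real)
qed

text \<open>The trace tells these projections apart from 0 and, when n is not 1, from the
  identity.\<close>

lemma trace_line_projection:
  assumes "x \<noteq> 0"
  shows "trace (line_projection x) = 1"
proof -
  have "trace (line_projection x) = (\<Sum>k\<in>UNIV. x $ k * cnj (x $ k)) / complex_of_real ((norm x)\<^sup>2)"
    by (simp add: trace_def line_projection_def sum_divide_distrib)
  with assms show ?thesis
    by (simp add: sum_mult_cnj del: of_real_power)
qed

theorem mainTheorem6:
  fixes \<rho> \<sigma> :: "complex^'n^'n" and q :: real
  assumes "CARD('n) \<ge> 3"
    and "q > 0"
    and "density_matrix \<rho>" and "density_matrix \<sigma>"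
    and "\<And>V. V \<in> contexts \<Longrightarrow>
           contextual_renyi_entropy q \<rho> V = contextual_renyi_entropy q \<sigma> V"
  shows "\<rho> = \<sigma>"
proof -
  have herm: "dagger \<rho> = \<rho>" "dagger \<sigma> = \<sigma>" and tr: "trace \<rho> = 1" "trace \<sigma> = 1"
    using assms by (auto simp: density_matrix_def positive_semidefinite_def)
  have "trace (mat 1 :: complex^'n^'n) = of_nat CARD('n)"
    by (simp add: trace_I)
  \<comment> \<open>That n is not 1 makes line projections nontrivial; that n is not 2 refutes the
    second alternative at the end.\<close>
  moreover have "(of_nat CARD('n) :: complex) \<noteq> of_nat 1" "(of_nat CARD('n) :: complex) \<noteq> of_nat 2"
    unfolding of_nat_eq_iff using assms(1) by auto
  ultimately have tr_ne: "trace (mat 1 :: complex^'n^'n) \<noteq> 1" "trace (mat 1 :: complex^'n^'n) \<noteq> 2"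
    by simp_all
  \<comment> \<open>Which alternative holds may depend on x; the product records both, and
    \<open>quad_mult_eq_0D\<close> then makes the choice uniform.\<close>
  have "quad (\<rho> - \<sigma>) x * quad (\<rho> + \<sigma> - mat 1) x = 0" for x
  proof (cases "x = 0")
    case True
    then show ?thesis by (simp add: quad_def sesq_def)
  next
    case False
    let ?P = "line_projection x"
    have "trace ?P = 1" by (rule trace_line_projection[OF False])
    then have P: "projection ?P" "?P \<noteq> 0" "?P \<noteq> mat 1"
      using tr_ne by (auto simp: projection_line_projection trace_0[unfolded mat_0])
    have "quad \<rho> x / (norm x)\<^sup>2 = quad \<sigma> x / (norm x)\<^sup>2 \<or>
        quad \<rho> x / (norm x)\<^sup>2 = 1 - quad \<sigma> x / (norm x)\<^sup>2"
      using contextual_renyi_entropy_eqD[OF assms(2-4) P assms(5)[OF binary_context_in_contexts[OF P]]]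
      by (simp only: Re_trace_mult_line_projection)
    then have "quad \<rho> x - quad \<sigma> x = 0 \<or> quad \<rho> x + quad \<sigma> x - (norm x)\<^sup>2 = 0"
      using False by (auto simp: field_simps)
    then show ?thesis
      by (auto simp: quad_diff_matrix quad_add_matrix quad_mat_1)
  qed
  then consider "\<And>x. quad (\<rho> - \<sigma>) x = 0" | "\<And>x. quad (\<rho> + \<sigma> - mat 1) x = 0"
    using quad_mult_eq_0D by blast
  then show ?thesis
  proof cases
    case 1
    then have "\<rho> - \<sigma> = 0"
      by (intro hermitian_eq_0I) (simp_all add: dagger_diff herm)
    then show ?thesis by simp
  next
    case 2
    \<comment> \<open>In dimension 2 this case does occur: a state and its complement I - \<rho>
      have equal entropies.\<close>
    then have "\<rho> + \<sigma> - mat 1 = 0"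
      by (intro hermitian_eq_0I) (simp_all add: dagger_diff dagger_add dagger_mat_1 herm)
    then have "trace (mat 1 :: complex^'n^'n) = trace (\<rho> + \<sigma>)" by simp
    with tr tr_ne show ?thesis by (simp add: trace_add)
  qed
qed

end
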